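(* Let $Q$ and $P$ be Borel probability measures over a Polish space $\Omega$ with $Q\ll P$. Then: (I) $D_{CS}[Q\|P]\ge 0$. (II) $D_{CS}[Q\|P]=0$ if and only if $Q=P$. (III) For fixed $P$, $D_{CS}[Q\|P]$ is convex in $Q$: for all Borel probability measures $Q_1,Q_2\ll P$ and $\lambda\in[0,1]$, $D_{CS}[\lambda Q_1+(1-\lambda)Q_2\|P]\le\lambda D_{CS}[Q_1\|P]+(1-\lambda)D_{CS}[Q_2\|P]$. (IV) With $\kappa=D_{\mathrm{KL}}[Q\|P]$, $$\kappa\le D_{CS}[Q\|P]\le\kappa+\log_2(\kappa+1)+1.$$ (V) If $\Omega$ is discrete, $x\in\Omega$ and $Q=\delta_x$ (the point mass at $x$, with $\delta_x\ll P$), then $D_{CS}[Q\|P]=-\log_2 P(\{x\})$.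
   Context: For $Q\ll P$ define $w(h)=P\left(\frac{dQ}{dP}\ge h\right)$ for $h\ge 0$. The channel simulation divergence is $$D_{CS}[Q\|P]=-\int_0^\infty w(h)\log_2 w(h)\,dh,$$ with the convention $0\log_2 0=0$; it may equal $+\infty$. The Kullback–Leibler divergence is in bits: $D_{\mathrm{KL}}[Q\|P]=\mathbb{E}_{Z\sim Q}\left[\log_2\frac{dQ}{dP}(Z)\right]\in[0,\infty]$. *)

theory Defs
  imports "HOL-Probability.Probability"
begin

definition borel_prob :: "'a::topological_space measure \<Rightarrow> bool" where
  "borel_prob M \<longleftrightarrow> prob_space M \<and> sets M = sets borel"

text \<open>
  The integral of a measurable real function with values in the extended reals, as positive part
  minus negative part. The Bochner integral does not serve here, since it returns \<open>0\<close> on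
  non-integrable functions. As \<open>\<infinity> - \<infinity> = \<infinity>\<close> in \<^typ>\<open>ereal\<close>, the value is meaningful only if one of
  the two parts is finite. In both uses below the integral exists in this sense: \<open>w log\<^sub>2 w\<close> is
  nonpositive, and \<open>log\<^sub>2 (dQ/dP)\<close> has \<open>Q\<close>-integrable negative part.
\<close>
definition extended_integral :: "'a measure \<Rightarrow> ('a \<Rightarrow> real) \<Rightarrow> ereal" where
  "extended_integral M f =
     enn2ereal (\<integral>\<^sup>+x. ennreal (f x) \<partial>M) - enn2ereal (\<integral>\<^sup>+x. ennreal (- f x) \<partial>M)"

definition width :: "'a measure \<Rightarrow> 'a measure \<Rightarrow> real \<Rightarrow> real" where
  "width Q P h = measure P {x \<in> space P. RN_deriv P Q x \<ge> ennreal h}"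

text \<open>The convention \<open>0 log\<^sub>2 0 = 0\<close> holds automatically because the left factor is \<open>0\<close>.\<close>
definition D_CS :: "'a measure \<Rightarrow> 'a measure \<Rightarrow> ereal" where
  "D_CS Q P =
     - extended_integral (restrict_space lborel {0..}) (\<lambda>h. width Q P h * log 2 (width Q P h))"

text \<open>
  Note the argument order: \<^term>\<open>entropy_density 2 P Q\<close> is \<open>log\<^sub>2 (dQ/dP)\<close>. The library's
  \<^const>\<open>KL_divergence\<close> is the Bochner integral of the same function, so it is \<open>0\<close> where the
  divergence is infinite.
\<close>
definition D_KL :: "'a measure \<Rightarrow> 'a measure \<Rightarrow> ereal" where
  "D_KL Q P = extended_integral Q (entropy_density 2 P Q)"

definition log2_ereal :: "ereal \<Rightarrow> ereal" where
  "log2_ereal x = (if x = \<infinity> then \<infinity> else if x > 0 then ereal (log 2 (real_of_ereal x)) else - \<infinity>)"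

definition mixture :: "real \<Rightarrow> 'a measure \<Rightarrow> 'a measure \<Rightarrow> 'a measure" where
  "mixture l Q1 Q2 = measure_of (space Q1) (sets Q1)
     (\<lambda>A. ennreal l * emeasure Q1 A + ennreal (1 - l) * emeasure Q2 A)"

lemma sets_mixture [simp]: "sets (mixture l Q1 Q2) = sets Q1"
  by (simp add: mixture_def)

lemma emeasure_mixture:
  assumes "sets Q2 = sets Q1" and "A \<in> sets Q1"
  shows "emeasure (mixture l Q1 Q2) A =
    ennreal l * emeasure Q1 A + ennreal (1 - l) * emeasure Q2 A"
  unfolding mixture_def
proof (rule emeasure_measure_of_sigma)
  show "countably_additive (sets Q1)
    (\<lambda>A. ennreal l * emeasure Q1 A + ennreal (1 - l) * emeasure Q2 A)"
  proof (rule countably_additiveI)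
    fix F :: "nat \<Rightarrow> 'a set"
    assume F: "range F \<subseteq> sets Q1" "disjoint_family F" "(\<Union>i. F i) \<in> sets Q1"
    show "(\<Sum>i. ennreal l * emeasure Q1 (F i) + ennreal (1 - l) * emeasure Q2 (F i)) =
      ennreal l * emeasure Q1 (\<Union>i. F i) + ennreal (1 - l) * emeasure Q2 (\<Union>i. F i)"
      using F assms(1) by (simp add: suminf_add[symmetric] suminf_emeasure)
  qed
qed (use assms in \<open>auto simp: positive_def sets.sigma_algebra_axioms\<close>)

end

(* Put r = dQ/dP and w(h) = P(r >= h). Tonelli gives int_0^oo w f dh = E_P[int_0^r f dh]; in
   particular w is a probability density on [0, oo), and up to the factor 1 / ln 2 the divergence
   D_CS is its differential entropy H, taken in nats below.

   Convexity: since t - t ln t = int_0^1 min(t,s)/s ds, the quantity H + 1 is a mixture of the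
   integrals int min(w,s) dh, and each of these equals min_{a >= 0} (s a + E_P[(r - a)^+]), which is
   convex in r.

   Lower bound: -ln w(h) >= 1 + ln r - r w(h); integrate over h <= r and take the expectation,
   using int_0^r w <= 1.

   Upper bound: Gibbs' inequality against the density q(h) = min(1, h^(-1-1/k)) / (1+k), together
   with E_w[(ln h)^+] <= E_P[r ln r]; k is the Kullback-Leibler divergence in bits, or 1 if
   that is 0.

   If H = 0, then w takes only the values 0 and 1, so it vanishes beyond 1 because its integral
   is 1; hence r <= 1 almost surely and Q = P. *)

theory Submission
  imports Defs
begin

section \<open>Scalar inequalities and one-dimensional integrals\<close>

lemma ennreal_add_le: "ennreal (a + b) \<le> ennreal a + ennreal b"
  by (cases "0 \<le> a"; cases "0 \<le> b")
     (auto simp: ennreal_neg ennreal_plus[symmetric] intro!: ennreal_leI simp del: ennreal_plus)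

lemma neg_x_ln_x_le:
  fixes t :: real assumes "0 \<le> t" shows "- (t * ln t) \<le> 1 - t"
proof (cases "t = 0")
  case False
  have "1 - t = t * (1 / t - 1)" using False by (simp add: field_simps)
  moreover have "t * ln (1 / t) \<le> t * (1 / t - 1)"
    using False assms by (intro mult_left_mono ln_le_minus_one) auto
  ultimately show ?thesis using False assms by (simp add: ln_div)
qed simp

text \<open>For \<open>r >= 1\<close> the antiderivative \<open>h * ln h - h\<close> gives equality;
  for \<open>r < 1\<close> the integral vanishes and \<open>neg_x_ln_x_le\<close> remains. In real
  terms the bound is \<open>r * ln r - r + 1\<close> for the integral of the positive part of
  \<open>ln\<close>. Negative terms are moved across because \<open>ennreal\<close> truncates at
  0.\<close>

lemma ln_integral_bound:
  fixes r :: real assumes "0 \<le> r"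
  shows "(\<integral>\<^sup>+h\<in>{0..r}. ennreal (ln h) \<partial>lborel) + ennreal (- (r * ln r)) + ennreal r \<le> ennreal (r * ln r) + 1"
proof (cases "r < 1")
  case True
  then have "r * ln r \<le> 0"
    using assms by (cases "r = 0") (auto simp: mult_nonneg_nonpos)
  moreover have "(\<integral>\<^sup>+h\<in>{0..r}. ennreal (ln h) \<partial>lborel) = (\<integral>\<^sup>+h. 0 \<partial>(lborel :: real measure))"
  proof (intro nn_integral_cong)
    fix h :: real
    have "h \<in> {0..r} \<Longrightarrow> ln h \<le> 0" using True by (cases "h = 0") auto
    then show "ennreal (ln h) * indicator {0..r} h = 0"
      by (auto simp: indicator_def ennreal_neg)
  qed
  moreover have "ennreal (- (r * ln r) + r) \<le> ennreal 1"
    using neg_x_ln_x_le[OF assms] by (intro ennreal_leI) simp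
  ultimately show ?thesis using assms
    by (simp add: ennreal_neg ennreal_plus[symmetric] ennreal_1[symmetric] del: ennreal_plus ennreal_1)
next
  case False
  then have r: "1 \<le> r" by simp
  have "(\<integral>\<^sup>+h\<in>{0..r}. ennreal (ln h) \<partial>lborel) = (\<integral>\<^sup>+h\<in>{1..r}. ennreal (ln h) \<partial>lborel)"
  proof (intro nn_integral_cong)
    fix h :: real
    have "h \<in> {0..<1} \<Longrightarrow> ln h \<le> 0" by (cases "h = 0") auto
    then show "ennreal (ln h) * indicator {0..r} h = ennreal (ln h) * indicator {1..r} h"
      by (auto simp: indicator_def ennreal_neg)
  qed
  also have "\<dots> = ennreal ((r * ln r - r) - (1 * ln 1 - 1))"
    by (rule nn_integral_FTC_Icc[where F = "\<lambda>h. h * ln h - h"])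
       (auto intro!: derivative_eq_intros simp: r)
  finally have "(\<integral>\<^sup>+h\<in>{0..r}. ennreal (ln h) \<partial>lborel) = ennreal (r * ln r - r + 1)" by simp
  moreover have "0 \<le> r * ln r - r + 1"
    using neg_x_ln_x_le[of r] r by linarith
  moreover have "0 \<le> r * ln r" using r by simp
  ultimately show ?thesis using r
    by (simp add: ennreal_neg ennreal_plus[symmetric] ennreal_1[symmetric] del: ennreal_plus ennreal_1)
qed

text \<open>The integrand is 1 below \<open>s = t\<close> and \<open>t / s\<close> above, where
  \<open>t * ln s\<close> is an antiderivative.\<close>

lemma nn_integral_min_div:
  fixes t :: real
  assumes t: "0 \<le> t" "t \<le> 1"
  shows "(\<integral>\<^sup>+s\<in>{0..1}. ennreal (min t s / s) \<partial>lborel) = ennreal (t - t * ln t)"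
proof (cases "t = 0")
  case True
  have "(\<integral>\<^sup>+s\<in>{0..1}. ennreal (min t s / s) \<partial>lborel) = (\<integral>\<^sup>+s. 0 \<partial>(lborel :: real measure))"
    using True by (intro nn_integral_cong) (auto simp: indicator_def)
  with True show ?thesis by simp
next
  case False
  \<comment> \<open>At \<open>s = 0\<close> the quotient is \<open>0 / 0 = 0\<close>, so the first
    interval is open there.\<close>
  have "(\<integral>\<^sup>+s\<in>{0..1}. ennreal (min t s / s) \<partial>lborel) =
    (\<integral>\<^sup>+s. indicator {0<..<t} s + ennreal (t / s) * indicator {t..1} s \<partial>lborel)"
    using False t by (intro nn_integral_cong) (auto simp: indicator_def min_def)
  also have "\<dots> = ennreal t + (\<integral>\<^sup>+s. ennreal (t / s) * indicator {t..1} s \<partial>lborel)"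
    using t by (subst nn_integral_add) auto
  also have "(\<integral>\<^sup>+s. ennreal (t / s) * indicator {t..1} s \<partial>lborel) = ennreal (t * ln 1 - t * ln t)"
    using t False by (intro nn_integral_FTC_Icc[where F = "\<lambda>s. t * ln s"]) (auto intro!: derivative_eq_intros)
  also have "ennreal t + ennreal (t * ln 1 - t * ln t) = ennreal (t - t * ln t)"
    using t False by (subst ennreal_plus[symmetric]) (auto simp: mult_nonneg_nonpos)
  finally show ?thesis .
qed

section \<open>Tails of a nonnegative random variable of mean one\<close>

locale mean_one = prob_space M for M :: "'a measure" +
  fixes X :: "'a \<Rightarrow> real"
  assumes X [measurable]: "X \<in> borel_measurable M"
    and X_nonneg: "0 \<le> X x"
    and mean: "(\<integral>\<^sup>+x. ennreal (X x) \<partial>M) = 1"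
begin

definition tail :: "real \<Rightarrow> real" where
  "tail h = prob {x \<in> space M. h \<le> X x}"

text \<open>The integrand is nonnegative because \<open>tail\<close> lies in [0, 1], so
  \<open>ennreal\<close> truncates nothing and infinite entropy is included.\<close>

definition tail_entropy :: ennreal where
  "tail_entropy = (\<integral>\<^sup>+h\<in>{0..}. ennreal (- (tail h * ln (tail h))) \<partial>lborel)"

lemma tail_nonneg [simp]: "0 \<le> tail h" and tail_le_1 [simp]: "tail h \<le> 1"
  by (simp_all add: tail_def)

lemma tail_antimono: "h \<le> h' \<Longrightarrow> tail h' \<le> tail h"
  unfolding tail_def by (rule finite_measure_mono) auto

lemma tail_measurable [measurable]: "tail \<in> borel_measurable borel"
proof -
  have "(\<lambda>h. - tail h) \<in> borel_measurable borel"
    by (rule borel_measurable_mono) (auto simp: mono_def tail_antimono)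
  then show ?thesis by simp
qed

lemma tail_nonpos: "h \<le> 0 \<Longrightarrow> tail h = 1"
proof -
  assume "h \<le> 0"
  then have "{x \<in> space M. h \<le> X x} = space M"
    using X_nonneg order_trans by blast
  then show ?thesis by (simp add: tail_def prob_space)
qed

text \<open>Both sides integrate \<open>f h\<close> over the region \<open>0 <= h <= X x\<close>;
  the slice at fixed \<open>h\<close> has measure \<open>tail h\<close>.\<close>

lemma tonelli_tail:
  assumes [measurable]: "f \<in> borel_measurable borel"
  shows "(\<integral>\<^sup>+h\<in>{0..}. ennreal (tail h) * f h \<partial>lborel) =
    (\<integral>\<^sup>+x. (\<integral>\<^sup>+h\<in>{0..X x}. f h \<partial>lborel) \<partial>M)"
proof -
  interpret pair_sigma_finite lborel M
    by (intro pair_sigma_finite.intro lborel.sigma_finite_measure_axioms sigma_finite_measure_axioms)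
  \<comment> \<open>The interval depends on \<open>x\<close>; written with \<open>if\<close>, the
    integrand is visibly measurable in both variables jointly.\<close>
  have "(\<integral>\<^sup>+x. (\<integral>\<^sup>+h\<in>{0..X x}. f h \<partial>lborel) \<partial>M) =
    (\<integral>\<^sup>+x. (\<integral>\<^sup>+h. (if 0 \<le> h \<and> h \<le> X x then f h else 0) \<partial>lborel) \<partial>M)"
    by (intro nn_integral_cong) (auto simp: indicator_def)
  also have "\<dots> = (\<integral>\<^sup>+h. (\<integral>\<^sup>+x. (if 0 \<le> h \<and> h \<le> X x then f h else 0) \<partial>M) \<partial>lborel)"
    by (rule Fubini') measurable
  also have "\<dots> = (\<integral>\<^sup>+h\<in>{0..}. ennreal (tail h) * f h \<partial>lborel)"
  proof (intro nn_integral_cong)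
    fix h :: real
    have "(\<integral>\<^sup>+x. (if 0 \<le> h \<and> h \<le> X x then f h else 0) \<partial>M) =
      (\<integral>\<^sup>+x. (f h * indicator {0..} h) * indicator {x \<in> space M. h \<le> X x} x \<partial>M)"
      by (intro nn_integral_cong) (auto simp: indicator_def)
    also have "\<dots> = (f h * indicator {0..} h) * emeasure M {x \<in> space M. h \<le> X x}"
      by (rule nn_integral_cmult_indicator) measurable
    finally show "(\<integral>\<^sup>+x. (if 0 \<le> h \<and> h \<le> X x then f h else 0) \<partial>M) =
      ennreal (tail h) * f h * indicator {0..} h"
      by (simp add: tail_def emeasure_eq_measure mult_ac)
  qed
  finally show ?thesis ..
qed

lemma nn_integral_Icc_measurable [measurable]:
  assumes [measurable]: "f \<in> borel_measurable borel"
  shows "(\<lambda>x. \<integral>\<^sup>+h\<in>{0..X x}. f h \<partial>lborel) \<in> borel_measurable M"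
proof -
  have "(\<lambda>x. \<integral>\<^sup>+h. (if 0 \<le> h \<and> h \<le> X x then f h else 0) \<partial>lborel) \<in> borel_measurable M"
    by measurable
  then show ?thesis
    by (rule measurable_cong[THEN iffD1, rotated]) (auto intro!: nn_integral_cong simp: indicator_def)
qed

lemma tail_integral: "(\<integral>\<^sup>+h\<in>{0..}. ennreal (tail h) \<partial>lborel) = 1"
proof -
  have "(\<integral>\<^sup>+h\<in>{0..}. ennreal (tail h) \<partial>lborel) = (\<integral>\<^sup>+x. (\<integral>\<^sup>+h\<in>{0..X x}. 1 \<partial>lborel) \<partial>M)"
    using tonelli_tail[of "\<lambda>_. 1"] by simp
  also have "\<dots> = (\<integral>\<^sup>+x. ennreal (X x) \<partial>M)"
    by (intro nn_integral_cong) (simp add: X_nonneg)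
  finally show ?thesis by (simp add: mean)
qed

text \<open>The 1 is the integral of \<open>tail\<close>. It supplies the linear term in
  \<open>t - t * ln t\<close>, used both for Gibbs' inequality and for the decomposition into capped
  integrals.\<close>

lemma tail_entropy_add_1:
  "tail_entropy + 1 = (\<integral>\<^sup>+h\<in>{0..}. (ennreal (- (tail h * ln (tail h))) + ennreal (tail h)) \<partial>lborel)"
  unfolding tail_entropy_def tail_integral[symmetric] distrib_right
  by (rule nn_integral_add[symmetric]) measurable

section \<open>Lower bound for the tail entropy\<close>

text \<open>The positive and negative parts of the mean of \<open>X * ln X\<close> are kept apart,
  since the positive one may be infinite.\<close>

definition x_ln_x_pos :: ennreal where "x_ln_x_pos = (\<integral>\<^sup>+x. ennreal (X x * ln (X x)) \<partial>M)"
definition x_ln_x_neg :: ennreal where "x_ln_x_neg = (\<integral>\<^sup>+x. ennreal (- (X x * ln (X x))) \<partial>M)"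

text \<open>Finiteness of the negative part makes the difference of the two parts
  meaningful.\<close>

lemma x_ln_x_neg_le_1: "x_ln_x_neg \<le> 1"
proof -
  have "x_ln_x_neg \<le> (\<integral>\<^sup>+x. 1 \<partial>M)"
    unfolding x_ln_x_neg_def
  proof (rule nn_integral_mono)
    fix x
    have "- (X x * ln (X x)) \<le> 1"
      using neg_x_ln_x_le[OF X_nonneg[of x]] X_nonneg[of x] by linarith
    then show "ennreal (- (X x * ln (X x))) \<le> 1"
      by (metis ennreal_1 ennreal_leI)
  qed
  then show ?thesis by (simp add: emeasure_space_1)
qed

text \<open>The inequality \<open>ln y <= y - 1\<close> at \<open>y = r * tail h\<close>, with
  \<open>r = X x\<close>, is integrated over \<open>h\<close> in [0, r] and then over
  \<open>x\<close>. The term \<open>r * tail h\<close> contributes at most \<open>r\<close>, of mean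
  1, which cancels.\<close>

lemma x_ln_x_pos_le: "x_ln_x_pos \<le> tail_entropy + x_ln_x_neg"
proof -
  \<comment> \<open>Here \<open>ln 0 = 0\<close> would break the pointwise bound below; \<open>top\<close> is harmless because \<open>0 * top = 0\<close>.\<close>
  define f where "f h = (if tail h = 0 then top else ennreal (- ln (tail h)))" for h
  have [measurable]: "f \<in> borel_measurable borel" unfolding f_def by measurable
  have eq: "tail_entropy = (\<integral>\<^sup>+x. (\<integral>\<^sup>+h\<in>{0..X x}. f h \<partial>lborel) \<partial>M)"
    unfolding tail_entropy_def tonelli_tail[OF \<open>f \<in> _\<close>, symmetric]
  proof (intro nn_integral_cong)
    fix h :: real
    show "ennreal (- (tail h * ln (tail h))) * indicator {0..} h = ennreal (tail h) * f h * indicator {0..} h"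
      using tail_nonneg[of h] by (simp add: f_def ennreal_mult'[symmetric])
  qed
  have *: "ennreal (X x) + ennreal (X x * ln (X x)) \<le>
      (\<integral>\<^sup>+h\<in>{0..X x}. f h \<partial>lborel) + ennreal (X x) + ennreal (- (X x * ln (X x)))" for x
  proof (cases "X x = 0")
    case False
    define r where "r = X x"
    have r: "0 < r" using False X_nonneg[of x] by (simp add: r_def)
    have pt: "ennreal (1 + ln r) \<le> f h + ennreal r * ennreal (tail h)" for h
    proof (cases "tail h = 0")
      case False
      then have t: "0 < tail h" using tail_nonneg[of h] by linarith
      have "ln (r * tail h) \<le> r * tail h - 1" using r t by (intro ln_le_minus_one) simp
      then have "1 + ln r \<le> - ln (tail h) + r * tail h" using r t by (simp add: ln_mult)
      then show ?thesis using r t tail_le_1[of h]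
        by (simp add: f_def ennreal_mult[symmetric] ennreal_plus[symmetric] ennreal_leI del: ennreal_plus)
    qed (simp add: f_def)
    have "ennreal (r * (1 + ln r)) = (\<integral>\<^sup>+h\<in>{0..r}. ennreal (1 + ln r) \<partial>lborel)"
      using r by (simp add: nn_integral_cmult_indicator ennreal_mult'[symmetric] mult.commute)
    also have "\<dots> \<le> (\<integral>\<^sup>+h\<in>{0..r}. (f h + ennreal r * ennreal (tail h)) \<partial>lborel)"
      by (intro nn_integral_mono mult_right_mono pt) auto
    also have "\<dots> = (\<integral>\<^sup>+h\<in>{0..r}. f h \<partial>lborel) + (\<integral>\<^sup>+h\<in>{0..r}. ennreal r * ennreal (tail h) \<partial>lborel)"
      by (simp add: distrib_right nn_integral_add)
    also have "(\<integral>\<^sup>+h\<in>{0..r}. ennreal r * ennreal (tail h) \<partial>lborel) \<le>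
        (\<integral>\<^sup>+h. ennreal r * (ennreal (tail h) * indicator {0..} h) \<partial>lborel)"
      by (intro nn_integral_mono) (auto simp: indicator_def)
    also have "\<dots> = ennreal r" by (simp add: nn_integral_cmult tail_integral)
    finally have "ennreal (r * (1 + ln r)) \<le> (\<integral>\<^sup>+h\<in>{0..r}. f h \<partial>lborel) + ennreal r"
      by (simp add: add_left_mono)
    moreover have "ennreal r + ennreal (r * ln r) \<le> ennreal (r * (1 + ln r)) + ennreal (- (r * ln r))"
    proof (cases "0 \<le> r * ln r")
      case True
      then show ?thesis using r
        by (simp add: ennreal_plus[symmetric] ennreal_leI distrib_left ennreal_neg del: ennreal_plus)
    next
      case False
      \<comment> \<open>Here \<open>r * (1 + ln r)\<close> may be negative and truncated to 0, so
        subadditivity of the positive part replaces additivity.\<close>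
      have "r = r * (1 + ln r) + - (r * ln r)" by (simp add: algebra_simps)
      then have "ennreal r \<le> ennreal (r * (1 + ln r)) + ennreal (- (r * ln r))"
        by (metis ennreal_add_le)
      with False show ?thesis by (simp add: ennreal_neg)
    qed
    ultimately show ?thesis unfolding r_def[symmetric]
      by (meson add_right_mono order_trans)
  qed simp
  have "(\<integral>\<^sup>+x. ennreal (X x) + ennreal (X x * ln (X x)) \<partial>M) \<le>
     (\<integral>\<^sup>+x. (\<integral>\<^sup>+h\<in>{0..X x}. f h \<partial>lborel) + ennreal (X x) + ennreal (- (X x * ln (X x))) \<partial>M)"
    by (intro nn_integral_mono *)
  then have "1 + x_ln_x_pos \<le> (tail_entropy + 1) + x_ln_x_neg"
    by (simp add: nn_integral_add eq x_ln_x_pos_def x_ln_x_neg_def mean)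
  then have "1 + x_ln_x_pos \<le> 1 + (tail_entropy + x_ln_x_neg)" by (simp add: ac_simps)
  then show ?thesis by (simp add: ennreal_add_left_cancel_le)
qed

section \<open>Upper bound for the tail entropy by Gibbs' inequality\<close>

text \<open>Since \<open>ennreal\<close> cuts off negative values, this is the moment of the
  positive part of \<open>ln h\<close> under the density \<open>tail\<close>.\<close>

definition log_moment :: ennreal where
  "log_moment = (\<integral>\<^sup>+h\<in>{0..}. ennreal (tail h) * ennreal (ln h) \<partial>lborel)"

text \<open>The pointwise bound \<open>ln_integral_bound\<close> at \<open>r = X x\<close>, averaged
  over \<open>x\<close>: the summands \<open>X x\<close> and 1 both have mean 1 and cancel.\<close>

lemma log_moment_add_x_ln_x_neg_le: "log_moment + x_ln_x_neg \<le> x_ln_x_pos"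
proof -
  have "(\<integral>\<^sup>+x. (\<integral>\<^sup>+h\<in>{0..X x}. ennreal (ln h) \<partial>lborel) + ennreal (- (X x * ln (X x))) + ennreal (X x) \<partial>M)
     \<le> (\<integral>\<^sup>+x. ennreal (X x * ln (X x)) + 1 \<partial>M)"
    by (intro nn_integral_mono ln_integral_bound X_nonneg)
  then have "log_moment + x_ln_x_neg + 1 \<le> x_ln_x_pos + 1"
    by (simp add: nn_integral_add log_moment_def tonelli_tail x_ln_x_pos_def x_ln_x_neg_def mean emeasure_space_1)
  then have "1 + (log_moment + x_ln_x_neg) \<le> 1 + x_ln_x_pos" by (simp only: ac_simps)
  then show ?thesis by (simp add: ennreal_add_left_cancel_le)
qed

text \<open>The right side is the cross entropy of \<open>tail\<close> relative to the density
  \<open>q\<close>. The parameter \<open>k\<close> stays free and is fixed only in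
  \<open>D_CS_le\<close>.\<close>

lemma tail_entropy_le:
  assumes k: "0 < k"
  shows "tail_entropy \<le> ennreal (ln (1 + k)) + ennreal (1 + 1 / k) * log_moment"
proof -
  \<comment> \<open>The power integrates to \<open>k\<close> over [1, oo) and the constant 1 to 1
    over [0, 1], whence the normalisation \<open>1 + k\<close>.\<close>
  define q where "q h = (if h \<le> 1 then 1 else h powr (- 1 - 1 / k)) / (1 + k)" for h :: real
  have [measurable]: "q \<in> borel_measurable borel" unfolding q_def by measurable
  have "(\<integral>\<^sup>+h\<in>{0..}. ennreal (q h) \<partial>lborel) =
    (\<integral>\<^sup>+h. ennreal (1 / (1 + k)) * indicator {0..<1} h +
        ennreal (h powr (- 1 - 1 / k) / (1 + k)) * indicator {1..} h \<partial>lborel)"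
    by (intro nn_integral_cong) (auto simp: indicator_def q_def)
  also have "\<dots> = ennreal (1 / (1 + k)) +
     (\<integral>\<^sup>+h. ennreal (h powr (- 1 - 1 / k) / (1 + k)) * indicator {1..} h \<partial>lborel)"
    by (subst nn_integral_add) (auto simp: nn_integral_cmult_indicator)
  also have "(\<integral>\<^sup>+h. ennreal (h powr (- 1 - 1 / k) / (1 + k)) * indicator {1..} h \<partial>lborel) =
     ennreal (0 - (- k / (1 + k) * 1 powr (- 1 / k)))"
  proof (rule nn_integral_FTC_atLeast[where F = "\<lambda>h. - k / (1 + k) * h powr (- 1 / k)"])
    show "((\<lambda>h. - k / (1 + k) * h powr (- 1 / k)) has_real_derivative h powr (- 1 - 1 / k) / (1 + k)) (at h)"
      if "1 \<le> h" for h
    proof -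
      have "((\<lambda>h. h powr (- 1 / k)) has_real_derivative (- 1 / k) * h powr (- 1 / k - 1)) (at h)"
        using that by (intro has_real_derivative_powr) simp
      from DERIV_cmult[OF this, of "- k / (1 + k)"]
      have "((\<lambda>h. - k / (1 + k) * h powr (- 1 / k)) has_real_derivative
          - k / (1 + k) * ((- 1 / k) * h powr (- 1 / k - 1))) (at h)" .
      moreover have "- k / (1 + k) * ((- 1 / k) * p) = p / (1 + k)" for p
        using k by (simp add: field_simps)
      moreover have "- 1 / k - 1 = - 1 - 1 / k" by simp
      ultimately show ?thesis by metis
    qed
    have "((\<lambda>h::real. h powr (- 1 / k)) \<longlongrightarrow> 0) at_top"
      using k by (intro tendsto_neg_powr filterlim_ident) auto
    from tendsto_mult_left[OF this, of "- k / (1 + k)"]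
    show "((\<lambda>h. - k / (1 + k) * h powr (- 1 / k)) \<longlongrightarrow> 0) at_top" by simp
  qed (use k in auto)
  also have "ennreal (1 / (1 + k)) + ennreal (0 - (- k / (1 + k) * 1 powr (- 1 / k))) = 1"
    using k by (simp add: ennreal_plus[symmetric] add_divide_distrib[symmetric] del: ennreal_plus)
  finally have q: "(\<integral>\<^sup>+h\<in>{0..}. ennreal (q h) \<partial>lborel) = 1" .
  let ?g = "\<lambda>h. ennreal (ln (1 + k)) + ennreal (1 + 1 / k) * ennreal (ln h)"
  \<comment> \<open>This is \<open>ln y <= y - 1\<close> at \<open>y = q h / tail h\<close>,
    multiplied by \<open>tail h\<close>. The extra terms \<open>tail h\<close> and
    \<open>q h\<close> both integrate to 1.\<close>
  have *: "ennreal (- (tail h * ln (tail h))) + ennreal (tail h) \<le> ennreal (tail h) * ?g h + ennreal (q h)"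
    if "0 \<le> h" for h
  proof (cases "tail h = 0")
    case False
    define t where "t = tail h"
    have t: "0 < t" "t \<le> 1" using False tail_nonneg[of h] by (auto simp: t_def less_le)
    have qpos: "0 < q h" using k that by (auto simp: q_def)
    \<comment> \<open>At \<open>h = 0\<close> the default \<open>ln 0 = 0\<close> agrees with
      \<open>q 0 = 1 / (1 + k)\<close>.\<close>
    have g: "ln (1 + k) + (1 + 1 / k) * max 0 (ln h) = - ln (q h)"
      using k that by (cases "h = 0") (auto simp: q_def ln_div ln_powr max_def field_simps)
    have "ln (q h / t) \<le> q h / t - 1" using qpos t by (intro ln_le_minus_one) simp
    then have "t * ln (q h / t) \<le> t * (q h / t - 1)" using t by (intro mult_left_mono) auto
    then have "- (t * ln t) + t \<le> t * (- ln (q h)) + q h"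
      using t qpos by (simp add: ln_div algebra_simps)
    then have "ennreal (- (t * ln t) + t) \<le> ennreal (t * (ln (1 + k) + (1 + 1 / k) * max 0 (ln h)) + q h)"
      unfolding g by (rule ennreal_leI)
    moreover have "ennreal (- (t * ln t) + t) = ennreal (- (t * ln t)) + ennreal t"
      using t by (intro ennreal_plus) (auto simp: mult_nonneg_nonpos)
    moreover have "ennreal (max 0 (ln h)) = ennreal (ln h)" by (simp add: max_def ennreal_neg)
    ultimately show ?thesis unfolding t_def[symmetric]
      using t qpos k by (simp add: ennreal_mult)
  qed simp
  have "tail_entropy + 1 = (\<integral>\<^sup>+h\<in>{0..}. (ennreal (- (tail h * ln (tail h))) + ennreal (tail h)) \<partial>lborel)"
    by (rule tail_entropy_add_1)
  also have "\<dots> \<le> (\<integral>\<^sup>+h\<in>{0..}. (ennreal (tail h) * ?g h + ennreal (q h)) \<partial>lborel)"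
    using * by (intro nn_integral_mono) (auto simp: indicator_def)
  also have "\<dots> = (\<integral>\<^sup>+h. ennreal (ln (1 + k)) * (ennreal (tail h) * indicator {0..} h) +
      (ennreal (1 + 1 / k) * (ennreal (tail h) * ennreal (ln h) * indicator {0..} h) +
       ennreal (q h) * indicator {0..} h) \<partial>lborel)"
    by (intro nn_integral_cong) (auto simp: indicator_def algebra_simps)
  also have "\<dots> = ennreal (ln (1 + k)) + (ennreal (1 + 1 / k) * log_moment + 1)"
    by (simp add: nn_integral_add nn_integral_cmult tail_integral log_moment_def q)
  finally have "1 + tail_entropy \<le> 1 + (ennreal (ln (1 + k)) + ennreal (1 + 1 / k) * log_moment)" by (simp only: ac_simps)
  then show ?thesis by (simp add: ennreal_add_left_cancel_le)
qed

section \<open>Capped tail integrals and their variational formula\<close>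

definition capped :: "real \<Rightarrow> ennreal" where
  "capped s = (\<integral>\<^sup>+h\<in>{0..}. ennreal (min (tail h) s) \<partial>lborel)"

lemma capped_measurable [measurable]: "capped \<in> borel_measurable borel"
  unfolding capped_def by measurable

text \<open>\<open>nn_integral_min_div\<close> at \<open>t = tail h\<close>, followed by exchanging
  the integrals over \<open>h\<close> and \<open>s\<close>.\<close>

lemma tail_entropy_eq_capped: "tail_entropy + 1 = (\<integral>\<^sup>+s\<in>{0..1}. ennreal (1 / s) * capped s \<partial>lborel)"
proof -
  have "tail_entropy + 1 = (\<integral>\<^sup>+h\<in>{0..}. (ennreal (- (tail h * ln (tail h))) + ennreal (tail h)) \<partial>lborel)"
    by (rule tail_entropy_add_1)
  also have "\<dots> = (\<integral>\<^sup>+h\<in>{0..}. (\<integral>\<^sup>+s\<in>{0..1}. ennreal (min (tail h) s / s) \<partial>lborel) \<partial>lborel)"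
  proof (intro nn_integral_cong arg_cong2[where f = "(*)"] refl)
    fix h
    have "tail h * ln (tail h) \<le> 0"
      using tail_nonneg[of h] tail_le_1[of h]
      by (cases "tail h = 0") (auto simp: mult_nonneg_nonpos less_le)
    then show "ennreal (- (tail h * ln (tail h))) + ennreal (tail h) =
        (\<integral>\<^sup>+s\<in>{0..1}. ennreal (min (tail h) s / s) \<partial>lborel)"
      by (simp add: nn_integral_min_div ennreal_plus[symmetric] del: ennreal_plus)
  qed
  also have "\<dots> = (\<integral>\<^sup>+h. (\<integral>\<^sup>+s. ennreal (min (tail h) s / s) * indicator {0..1} s * indicator {0..} h \<partial>lborel) \<partial>lborel)"
    by (simp add: nn_integral_multc)
  also have "\<dots> = (\<integral>\<^sup>+s. (\<integral>\<^sup>+h. ennreal (min (tail h) s / s) * indicator {0..1} s * indicator {0..} h \<partial>lborel) \<partial>lborel)"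
    by (rule lborel_pair.Fubini') measurable
  also have "\<dots> = (\<integral>\<^sup>+s\<in>{0..1}. ennreal (1 / s) * capped s \<partial>lborel)"
  proof (intro nn_integral_cong)
    fix s :: real
    have "(\<integral>\<^sup>+h. ennreal (min (tail h) s / s) * indicator {0..1} s * indicator {0..} h \<partial>lborel) =
      (\<integral>\<^sup>+h. (ennreal (1 / s) * indicator {0..1} s) * (ennreal (min (tail h) s) * indicator {0..} h) \<partial>lborel)"
      by (intro nn_integral_cong) (auto simp: indicator_def ennreal_mult'[symmetric])
    also have "\<dots> = ennreal (1 / s) * indicator {0..1} s * capped s"
      unfolding capped_def by (rule nn_integral_cmult) measurable
    finally show "(\<integral>\<^sup>+h. ennreal (min (tail h) s / s) * indicator {0..1} s * indicator {0..} h \<partial>lborel) =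
      ennreal (1 / s) * capped s * indicator {0..1} s" by (simp add: mult_ac)
  qed
  finally show ?thesis .
qed

text \<open>\<open>tonelli_tail\<close> for the indicator of [a, oo): the interval from
  \<open>a\<close> to \<open>X x\<close> has length the positive part of
  \<open>X x - a\<close>.\<close>

lemma nn_integral_excess:
  assumes "0 \<le> a"
  shows "(\<integral>\<^sup>+x. ennreal (X x - a) \<partial>M) = (\<integral>\<^sup>+h\<in>{a..}. ennreal (tail h) \<partial>lborel)"
proof -
  have "(\<integral>\<^sup>+h\<in>{a..}. ennreal (tail h) \<partial>lborel) = (\<integral>\<^sup>+h\<in>{0..}. ennreal (tail h) * indicator {a..} h \<partial>lborel)"
    using assms by (intro nn_integral_cong) (auto simp: indicator_def)
  also have "\<dots> = (\<integral>\<^sup>+x. (\<integral>\<^sup>+h\<in>{0..X x}. indicator {a..} h \<partial>lborel) \<partial>M)"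
    by (rule tonelli_tail) measurable
  also have "\<dots> = (\<integral>\<^sup>+x. ennreal (X x - a) \<partial>M)"
  proof (intro nn_integral_cong)
    fix x
    have "(\<integral>\<^sup>+h\<in>{0..X x}. indicator {a..} h \<partial>lborel) = (\<integral>\<^sup>+h. indicator {a..X x} h \<partial>lborel)"
      using assms by (intro nn_integral_cong) (auto simp: indicator_def)
    also have "\<dots> = ennreal (X x - a)"
      by (cases "a \<le> X x") (auto simp: ennreal_neg)
    finally show "(\<integral>\<^sup>+h\<in>{0..X x}. indicator {a..} h \<partial>lborel) = ennreal (X x - a)" .
  qed
  finally show ?thesis ..
qed

text \<open>The minimum is bounded by \<open>s\<close> before \<open>a\<close> and by
  \<open>tail h\<close> from \<open>a\<close> on.\<close>

lemma capped_le:
  assumes "0 \<le> a" "0 \<le> s"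
  shows "capped s \<le> ennreal (s * a) + (\<integral>\<^sup>+x. ennreal (X x - a) \<partial>M)"
proof -
  have "capped s \<le> (\<integral>\<^sup>+h. ennreal s * indicator {0..<a} h + ennreal (tail h) * indicator {a..} h \<partial>lborel)"
    unfolding capped_def by (intro nn_integral_mono) (auto simp: indicator_def ennreal_leI)
  also have "\<dots> = ennreal (s * a) + (\<integral>\<^sup>+x. ennreal (X x - a) \<partial>M)"
    using assms by (subst nn_integral_add) (auto simp: nn_integral_cmult_indicator nn_integral_excess ennreal_mult)
  finally show ?thesis .
qed

text \<open>On [0, h] the decreasing \<open>tail\<close> is at least \<open>tail h\<close>, and its
  total integral is 1.\<close>

lemma tail_markov: "0 \<le> h \<Longrightarrow> h * tail h \<le> 1"
proof -
  assume h: "0 \<le> h"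
  have "ennreal (h * tail h) = (\<integral>\<^sup>+u\<in>{0..h}. ennreal (tail h) \<partial>lborel)"
    using h by (simp add: nn_integral_cmult_indicator ennreal_mult' mult.commute)
  also have "\<dots> \<le> (\<integral>\<^sup>+u\<in>{0..}. ennreal (tail u) \<partial>lborel)"
    by (intro nn_integral_mono) (auto simp: indicator_def intro!: ennreal_leI tail_antimono)
  finally show ?thesis by (simp add: tail_integral)
qed

text \<open>The optimal \<open>a\<close> is where the decreasing \<open>tail\<close> crosses the
  level \<open>s\<close>: there the two bounds in \<open>capped_le\<close> become equalities.
  Markov's inequality gives \<open>a <= 1 / s\<close>, so the supremum exists.\<close>

lemma capped_attained:
  assumes s: "0 < s" "s \<le> 1"
  obtains a where "0 \<le> a" "capped s = ennreal (s * a) + (\<integral>\<^sup>+x. ennreal (X x - a) \<partial>M)"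
proof -
  define a where "a = Sup {h. 0 \<le> h \<and> s \<le> tail h}"
  have bdd: "bdd_above {h. 0 \<le> h \<and> s \<le> tail h}"
  proof (rule bdd_aboveI)
    fix h assume h: "h \<in> {h. 0 \<le> h \<and> s \<le> tail h}"
    then have "h * s \<le> h * tail h" by (intro mult_left_mono) auto
    also have "\<dots> \<le> 1" using h by (intro tail_markov) auto
    finally show "h \<le> 1 / s" using s by (simp add: field_simps)
  qed
  have zero: "0 \<in> {h. 0 \<le> h \<and> s \<le> tail h}" using s by (simp add: tail_nonpos)
  have a: "0 \<le> a" unfolding a_def by (rule cSup_upper[OF zero bdd])
  have below: "s \<le> tail h" if "h < a" for h
  proof -
    from that obtain h' where "s \<le> tail h'" "h < h'"
      unfolding a_def using less_cSup_iff[OF _ bdd] zero by blast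
    then show ?thesis using tail_antimono[of h h'] by linarith
  qed
  have above: "tail h \<le> s" if "a < h" for h
  proof (rule ccontr)
    assume "\<not> tail h \<le> s"
    then have "h \<le> a" unfolding a_def using that a by (intro cSup_upper[OF _ bdd]) auto
    with that show False by simp
  qed
  have "capped s = (\<integral>\<^sup>+h. ennreal s * indicator {0..<a} h + ennreal (tail h) * indicator {a..} h \<partial>lborel)"
    unfolding capped_def
  \<comment> \<open>At the crossing point itself \<open>tail\<close> may still exceed
    \<open>s\<close>, so the equality holds only off \<open>a\<close>.\<close>
  proof (rule nn_integral_cong_AE, use AE_lborel_singleton[of a] in eventually_elim)
    fix h assume "h \<noteq> a"
    then show "ennreal (min (tail h) s) * indicator {0..} h =
        ennreal s * indicator {0..<a} h + ennreal (tail h) * indicator {a..} h"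
      using below[of h] above[of h] a by (auto simp: indicator_def min_def)
  qed
  also have "\<dots> = ennreal (s * a) + (\<integral>\<^sup>+x. ennreal (X x - a) \<partial>M)"
    using a s by (subst nn_integral_add) (auto simp: nn_integral_cmult_indicator nn_integral_excess ennreal_mult)
  finally show ?thesis using that a by blast
qed

section \<open>Vanishing entropy and two-valued variables\<close>

lemma AE_le_1_if_tail_entropy_0:
  assumes "tail_entropy = 0"
  shows "AE x in M. X x \<le> 1"
proof -
  have "AE h in lborel. ennreal (- (tail h * ln (tail h))) * indicator {0..} h = 0"
    using assms unfolding tail_entropy_def by (subst (asm) nn_integral_0_iff_AE) auto
  then have 01: "AE h in lborel. 0 \<le> h \<longrightarrow> tail h = 0 \<or> tail h = 1"
  proof eventually_elim
    case (elim h)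
    show ?case
    proof (intro impI)
      assume "0 \<le> h"
      with elim have "0 \<le> tail h * ln (tail h)" by (auto simp: ennreal_eq_0_iff)
      moreover have "tail h * ln (tail h) < 0" if "0 < tail h" "tail h < 1"
        using that by (intro mult_pos_neg) auto
      ultimately show "tail h = 0 \<or> tail h = 1"
        using tail_nonneg[of h] tail_le_1[of h] by (smt (verit))
    qed
  qed
  have tail_0: "tail h = 0" if h: "1 < h" for h
  proof -
    \<comment> \<open>The values 0 and 1 are known only for almost every argument, so one is picked
      in an interval of positive length; monotonicity then carries the value 0 on to
      \<open>h\<close>.\<close>
    have "\<exists>h'\<in>{1<..<h}. tail h' = 0 \<or> tail h' = 1"
    proof (rule ccontr)
      assume "\<not> ?thesis"
      then have "AE u in lborel. u \<notin> {1<..<h}" using 01 by (auto elim!: eventually_mono)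
      then have "emeasure lborel {1<..<h} = 0" 
        by (subst (asm) AE_iff_measurable[of "{1<..<h}"]) auto
      with h show False by simp
    qed
    then obtain h' where h': "1 < h'" "h' < h" "tail h' = 0 \<or> tail h' = 1" by auto
    then have "tail h' = 0" using tail_markov[of h'] by auto
    then show ?thesis using tail_antimono[of h' h] tail_nonneg[of h] h' by simp
  qed
  \<comment> \<open>\<open>tail\<close> measures events with a weak inequality, so
    \<open>X x > 1\<close> is covered by countably many of them.\<close>
  have "AE x in M. \<forall>n::nat. \<not> 1 + 1 / real (Suc n) \<le> X x"
  proof (subst AE_all_countable, intro allI)
    fix n
    have "prob {x \<in> space M. 1 + 1 / real (Suc n) \<le> X x} = 0"
      using tail_0[of "1 + 1 / real (Suc n)"] by (simp add: tail_def)
    then show "AE x in M. \<not> 1 + 1 / real (Suc n) \<le> X x"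
      by (subst AE_iff_measurable[OF _ refl]) (auto simp: emeasure_eq_measure)
  qed
  then show ?thesis
  proof eventually_elim
    case (elim x)
    show ?case
    proof (rule ccontr)
      assume "\<not> X x \<le> 1"
      then obtain n where "inverse (real (Suc n)) < X x - 1"
        using reals_Archimedean[of "X x - 1"] by auto
      then show False using elim[rule_format, of n] by (simp add: inverse_eq_divide)
    qed
  qed
qed

text \<open>Mean one forces \<open>prob S = 1 / c\<close>, so \<open>tail\<close> equals
  \<open>1 / c\<close> on (0, c] and 0 beyond. The case \<open>c = 1\<close> serves
  \<open>Q = P\<close>, the case \<open>c = 1 / p\<close> a point mass at an atom of mass
  \<open>p\<close>.\<close>

lemma tail_entropy_two_valued:
  assumes S [measurable]: "S \<in> sets M" and c: "0 < c"
    and X: "AE x in M. X x = c * indicator S x"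
  shows "tail_entropy = ennreal (ln c)"
proof -
  have "1 = (\<integral>\<^sup>+x. ennreal c * indicator S x \<partial>M)"
    unfolding mean[symmetric]
    by (rule nn_integral_cong_AE, use X in eventually_elim) (auto simp: indicator_def)
  also have "\<dots> = ennreal (c * prob S)"
    using c by (simp add: nn_integral_cmult_indicator emeasure_eq_measure ennreal_mult')
  finally have p: "prob S = 1 / c" using c by (simp add: field_simps)
  have *: "tail h = (if h \<le> c then 1 / c else 0)" if h: "0 < h" for h
  proof -
    have "tail h = prob (if h \<le> c then S else {})"
      unfolding tail_def
      by (rule measure_eq_AE, use X in eventually_elim)
         (use h S[THEN sets.sets_into_space] in \<open>auto simp: indicator_def\<close>)
    then show ?thesis using p by simp
  qed
  have c1: "1 \<le> c" using c prob_le_1[of S] unfolding p by (simp add: field_simps)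
  have "tail_entropy = (\<integral>\<^sup>+h. ennreal (ln c / c) * indicator {0..c} h \<partial>lborel)"
    unfolding tail_entropy_def
  \<comment> \<open>The point 0 is left out because \<open>tail 0\<close> is 1 whatever
    \<open>c\<close> is.\<close>
  proof (rule nn_integral_cong_AE, use AE_lborel_singleton[of 0] in eventually_elim)
    fix h :: real assume "h \<noteq> 0"
    then show "ennreal (- (tail h * ln (tail h))) * indicator {0..} h = ennreal (ln c / c) * indicator {0..c} h"
      using * c by (auto simp: indicator_def ln_div)
  qed
  also have "\<dots> = ennreal (ln c)"
    using c c1 by (simp add: nn_integral_cmult_indicator ennreal_mult'[symmetric])
  finally show ?thesis .
qed

end

section \<open>Convexity of the tail entropy in the random variable\<close>

text \<open>The mean of the positive part of \<open>X - a\<close>, plus \<open>s * a\<close>, is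
  jointly convex in \<open>a\<close> and \<open>X\<close>, so its minimum over \<open>a\<close> is
  convex in \<open>X\<close>. Integrating over \<open>s\<close> with weight \<open>1 / s\<close>
  preserves this.\<close>

lemma tail_entropy_convex:
  assumes "mean_one M X1" "mean_one M X2" "mean_one M X"
    and comb: "AE x in M. X x = l * X1 x + (1 - l) * X2 x" and l: "0 \<le> l" "l \<le> 1"
  shows "mean_one.tail_entropy M X \<le> ennreal l * mean_one.tail_entropy M X1 + ennreal (1 - l) * mean_one.tail_entropy M X2"
proof -
  interpret A: mean_one M X1 by fact
  interpret B: mean_one M X2 by fact
  interpret mean_one M X by fact
  have le: "capped s \<le> ennreal l * A.capped s + ennreal (1 - l) * B.capped s" if s: "0 < s" "s \<le> 1" for s
  proof -
    obtain a where a: "0 \<le> a" "A.capped s = ennreal (s * a) + (\<integral>\<^sup>+x. ennreal (X1 x - a) \<partial>M)"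
      using A.capped_attained[OF s] .
    obtain b where b: "0 \<le> b" "B.capped s = ennreal (s * b) + (\<integral>\<^sup>+x. ennreal (X2 x - b) \<partial>M)"
      using B.capped_attained[OF s] .
    \<comment> \<open>The same combination of the two minimisers is a competitor for
      \<open>X\<close>; it need not be optimal.\<close>
    define d where "d = l * a + (1 - l) * b"
    have "0 \<le> d" using a b l by (simp add: d_def)
    then have "capped s \<le> ennreal (s * d) + (\<integral>\<^sup>+x. ennreal (X x - d) \<partial>M)"
      using s by (intro capped_le) auto
    also have "(\<integral>\<^sup>+x. ennreal (X x - d) \<partial>M) \<le>
        (\<integral>\<^sup>+x. ennreal l * ennreal (X1 x - a) + ennreal (1 - l) * ennreal (X2 x - b) \<partial>M)"
    proof (rule nn_integral_mono_AE, use comb in eventually_elim)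
      fix x assume "X x = l * X1 x + (1 - l) * X2 x"
      then have "X x - d = l * (X1 x - a) + (1 - l) * (X2 x - b)"
        by (simp add: d_def algebra_simps)
      then show "ennreal (X x - d) \<le> ennreal l * ennreal (X1 x - a) + ennreal (1 - l) * ennreal (X2 x - b)"
        using l by (metis ennreal_add_le ennreal_mult' diff_ge_0_iff_ge)
    qed
    also have "\<dots> = ennreal l * (\<integral>\<^sup>+x. ennreal (X1 x - a) \<partial>M) + ennreal (1 - l) * (\<integral>\<^sup>+x. ennreal (X2 x - b) \<partial>M)"
      by (simp add: nn_integral_add nn_integral_cmult)
    also have "ennreal (s * d) = ennreal l * ennreal (s * a) + ennreal (1 - l) * ennreal (s * b)"
      using s l a b by (simp add: d_def ennreal_mult'[symmetric] ennreal_plus[symmetric] algebra_simps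
          mult_left_mono del: ennreal_plus)
    finally show ?thesis unfolding a b by (simp add: distrib_left ac_simps add_left_mono)
  qed
  have "tail_entropy + 1 \<le> (\<integral>\<^sup>+s\<in>{0..1}. (ennreal (1 / s) * (ennreal l * A.capped s + ennreal (1 - l) * B.capped s)) \<partial>lborel)"
    unfolding tail_entropy_eq_capped
  proof (rule nn_integral_mono)
    fix s :: real
    show "ennreal (1 / s) * capped s * indicator {0..1} s \<le>
        ennreal (1 / s) * (ennreal l * A.capped s + ennreal (1 - l) * B.capped s) * indicator {0..1} s"
      \<comment> \<open>At \<open>s = 0\<close> the weight \<open>1 / s\<close> is 0 by default, so
        both sides vanish.\<close>
      using le[of s] by (cases "s = 0") (auto simp: indicator_def intro!: mult_left_mono)
  qed
  also have "\<dots> = (\<integral>\<^sup>+s. ennreal l * (ennreal (1 / s) * A.capped s * indicator {0..1} s) +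
      ennreal (1 - l) * (ennreal (1 / s) * B.capped s * indicator {0..1} s) \<partial>lborel)"
    by (intro nn_integral_cong) (simp add: algebra_simps)
  also have "\<dots> = ennreal l * (A.tail_entropy + 1) + ennreal (1 - l) * (B.tail_entropy + 1)"
    by (simp add: nn_integral_add nn_integral_cmult A.tail_entropy_eq_capped B.tail_entropy_eq_capped)
  also have "\<dots> = (ennreal l + ennreal (1 - l)) + (ennreal l * A.tail_entropy + ennreal (1 - l) * B.tail_entropy)"
    by (simp add: distrib_left ac_simps)
  also have "ennreal l + ennreal (1 - l) = 1"
    using l by (simp add: ennreal_plus[symmetric] del: ennreal_plus)
  finally have "1 + tail_entropy \<le> 1 + (ennreal l * A.tail_entropy + ennreal (1 - l) * B.tail_entropy)" by (simp only: ac_simps)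
  then show ?thesis by (simp add: ennreal_add_left_cancel_le)
qed

section \<open>From random variables to pairs of measures\<close>

locale ac_pair = P: prob_space P + Q: prob_space Q for P Q :: "'a measure" +
  assumes sets_Q [measurable_cong]: "sets Q = sets P"
    and ac: "absolutely_continuous P Q"
begin

text \<open>\<open>enn2real\<close> sends \<open>top\<close> to 0; as the derivative is finite
  almost everywhere, passing to real values changes it only on a null set.\<close>

lemma AE_RN_deriv: "AE x in P. RN_deriv P Q x = ennreal (enn2real (RN_deriv P Q x))"
  using P.RN_deriv_finite[OF Q.sigma_finite_measure_axioms ac sets_Q]
  by eventually_elim (simp add: less_top)

lemma density_eq: "density P (\<lambda>x. ennreal (enn2real (RN_deriv P Q x))) = Q"
proof -
  have "density P (\<lambda>x. ennreal (enn2real (RN_deriv P Q x))) = density P (RN_deriv P Q)"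
    using AE_RN_deriv by (intro density_cong) auto
  then show ?thesis using P.density_RN_deriv[OF ac sets_Q] by simp
qed

lemma nn_integral_Q:
  assumes [measurable]: "f \<in> borel_measurable P"
  shows "(\<integral>\<^sup>+x. f x \<partial>Q) = (\<integral>\<^sup>+x. ennreal (enn2real (RN_deriv P Q x)) * f x \<partial>P)"
  by (subst density_eq[symmetric], subst nn_integral_density) auto

text \<open>The mean of the real-valued derivative is the total mass of \<open>Q\<close>, which
  makes all results on tails available.\<close>

sublocale mean_one P "\<lambda>x. enn2real (RN_deriv P Q x)"
proof
  show "(\<integral>\<^sup>+x. ennreal (enn2real (RN_deriv P Q x)) \<partial>P) = 1"
    using nn_integral_Q[of "\<lambda>_. 1"] by (simp add: Q.emeasure_space_1)
qed auto

lemma width_eq_tail: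
  assumes "0 \<le> h"
  shows "width Q P h = tail h"
  unfolding width_def tail_def
proof (rule measure_eq_AE, use AE_RN_deriv in eventually_elim)
  fix x assume "RN_deriv P Q x = ennreal (enn2real (RN_deriv P Q x))"
  then have "ennreal h \<le> RN_deriv P Q x \<longleftrightarrow> h \<le> enn2real (RN_deriv P Q x)"
    using assms by (metis ennreal_le_iff enn2real_nonneg)
  then show "x \<in> {x \<in> space P. ennreal h \<le> RN_deriv P Q x} \<longleftrightarrow>
      x \<in> {x \<in> space P. h \<le> enn2real (RN_deriv P Q x)}" by simp
qed measurable

text \<open>The integrand in \<open>D_CS\<close> is nonpositive, so only the negative part of
  \<open>extended_integral\<close> survives; the factor changes nats to bits.\<close>

lemma D_CS_eq: "D_CS Q P = enn2ereal (ennreal (1 / ln 2) * tail_entropy)"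
proof -
  have neg: "width Q P h * log 2 (width Q P h) \<le> 0" for h
    unfolding width_def by (cases "measure P {x \<in> space P. ennreal h \<le> RN_deriv P Q x} = 0")
      (auto intro!: mult_nonneg_nonpos simp: measure_nonneg P.prob_le_1 less_le)
  have "(\<integral>\<^sup>+h. ennreal (- (width Q P h * log 2 (width Q P h))) \<partial>restrict_space lborel {0..}) =
     (\<integral>\<^sup>+h\<in>{0..}. ennreal (- (width Q P h * log 2 (width Q P h))) \<partial>lborel)"
    by (rule nn_integral_restrict_space) simp
  also have "\<dots> = (\<integral>\<^sup>+h. ennreal (1 / ln 2) * (ennreal (- (tail h * ln (tail h))) * indicator {0..} h) \<partial>lborel)"
  proof (intro nn_integral_cong)
    fix h :: real
    show "ennreal (- (width Q P h * log 2 (width Q P h))) * indicator {0..} h =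
       ennreal (1 / ln 2) * (ennreal (- (tail h * ln (tail h))) * indicator {0..} h)"
      by (auto simp: indicator_def width_eq_tail log_def ennreal_mult'[symmetric])
  qed
  also have "\<dots> = ennreal (1 / ln 2) * tail_entropy"
    unfolding tail_entropy_def by (rule nn_integral_cmult) measurable
  finally show ?thesis
    using neg by (simp add: D_CS_def extended_integral_def ennreal_neg zero_ennreal.rep_eq)
qed

text \<open>Passing from \<open>Q\<close> to \<open>P\<close> multiplies the integrand by the
  density, turning the logarithm into \<open>X * ln X\<close>, separately for each sign.\<close>

lemma D_KL_eq:
  "D_KL Q P = enn2ereal (ennreal (1 / ln 2) * x_ln_x_pos) - enn2ereal (ennreal (1 / ln 2) * x_ln_x_neg)"
proof -
  define c :: real where "c = 1 / ln 2"
  have c: "0 \<le> c" by (simp add: c_def)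
  have ed: "entropy_density 2 P Q x = c * ln (enn2real (RN_deriv P Q x))" for x
    by (simp add: entropy_density_def log_def c_def)
  have "(\<integral>\<^sup>+x. ennreal (entropy_density 2 P Q x) \<partial>Q) = ennreal c * x_ln_x_pos"
    unfolding ed x_ln_x_pos_def
    by (subst nn_integral_Q, measurable, subst nn_integral_cmult[symmetric], measurable)
       (intro nn_integral_cong, simp add: ennreal_mult'[symmetric] c mult_ac)
  moreover have "(\<integral>\<^sup>+x. ennreal (- entropy_density 2 P Q x) \<partial>Q) = ennreal c * x_ln_x_neg"
    unfolding ed x_ln_x_neg_def
    by (subst nn_integral_Q, measurable, subst nn_integral_cmult[symmetric], measurable)
       (intro nn_integral_cong, simp add: ennreal_mult'[symmetric] c mult_ac)
  ultimately show ?thesis by (simp add: D_KL_def extended_integral_def c_def)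
qed

text \<open>A density bounded by 1 makes \<open>Q\<close> at most \<open>P\<close> on every
  measurable set; complements give the reverse inequality because both masses are 1.\<close>

lemma tail_entropy_eq_0_iff: "tail_entropy = 0 \<longleftrightarrow> Q = P"
proof
  assume "tail_entropy = 0"
  from AE_le_1_if_tail_entropy_0[OF this] have le: "AE x in P. ennreal (enn2real (RN_deriv P Q x)) \<le> 1"
    by eventually_elim simp
  have QP: "Q.prob A \<le> P.prob A" if [measurable]: "A \<in> sets P" for A
  proof -
    have "emeasure Q A = (\<integral>\<^sup>+x. ennreal (enn2real (RN_deriv P Q x)) * indicator A x \<partial>P)"
      by (subst density_eq[symmetric], subst emeasure_density) auto
    also have "\<dots> \<le> (\<integral>\<^sup>+x. indicator A x \<partial>P)"
      by (rule nn_integral_mono_AE, use le in eventually_elim) (auto simp: indicator_def)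
    finally show ?thesis by (simp add: P.emeasure_eq_measure Q.emeasure_eq_measure)
  qed
  show "Q = P"
  proof (rule measure_eqI[OF sets_Q])
    fix A assume A: "A \<in> sets Q"
    then have "Q.prob (space Q - A) \<le> P.prob (space P - A)"
      using QP[of "space P - A"] sets_Q sets_eq_imp_space_eq[OF sets_Q] by auto
    then have "P.prob A \<le> Q.prob A"
      using A sets_Q by (simp add: P.prob_compl Q.prob_compl)
    with QP[of A] A sets_Q show "emeasure Q A = emeasure P A"
      by (simp add: P.emeasure_eq_measure Q.emeasure_eq_measure)
  qed
next
  assume "Q = P"
  then have "density P (\<lambda>_. 1) = Q" by (simp add: density_1)
  then have "AE x in P. 1 = RN_deriv P Q x" by (intro P.RN_deriv_unique) auto
  then have "AE x in P. enn2real (RN_deriv P Q x) = 1 * indicator (space P) x"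
    using AE_space by eventually_elim (metis enn2real_1 indicator_simps(1) mult_1)
  then have "tail_entropy = ennreal (ln 1)" by (intro tail_entropy_two_valued) auto
  then show "tail_entropy = 0" by simp
qed

lemma D_CS_eq_0_iff: "D_CS Q P = 0 \<longleftrightarrow> Q = P"
proof -
  have "D_CS Q P = 0 \<longleftrightarrow> ennreal (1 / ln 2) * tail_entropy = 0"
    unfolding D_CS_eq by (metis enn2ereal_inject zero_ennreal.rep_eq)
  then show ?thesis by (simp add: tail_entropy_eq_0_iff)
qed

lemma D_KL_le_D_CS: "D_KL Q P \<le> D_CS Q P"
proof -
  have "x_ln_x_neg \<noteq> top" using x_ln_x_neg_le_1 by (auto simp: top_unique)
  then have fin: "ennreal (1 / ln 2) * x_ln_x_neg \<noteq> top" by (simp add: ennreal_mult_eq_top_iff)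
  have "ennreal (1 / ln 2) * x_ln_x_pos \<le> ennreal (1 / ln 2) * tail_entropy + ennreal (1 / ln 2) * x_ln_x_neg"
    unfolding distrib_left[symmetric] by (rule mult_left_mono[OF x_ln_x_pos_le]) simp
  then have "enn2ereal (ennreal (1 / ln 2) * x_ln_x_pos) \<le>
      enn2ereal (ennreal (1 / ln 2) * tail_entropy) + enn2ereal (ennreal (1 / ln 2) * x_ln_x_neg)"
    by (simp add: less_eq_ennreal.rep_eq plus_ennreal.rep_eq)
  then show ?thesis unfolding D_KL_eq D_CS_eq
    using fin by (subst ereal_minus_le) auto
qed

text \<open>If \<open>x_ln_x_pos\<close> is infinite, so is the right side. Otherwise all quantities
  are finite and \<open>tail_entropy_le\<close> applies with \<open>k\<close> tuned to the
  divergence.\<close>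

lemma D_CS_le: "D_CS Q P \<le> D_KL Q P + log2_ereal (D_KL Q P + 1) + 1"
proof (cases "x_ln_x_pos = top")
  case True
  have "x_ln_x_neg \<noteq> top" using x_ln_x_neg_le_1 by (auto simp: top_unique)
  then have "ennreal (1 / ln 2) * x_ln_x_neg \<noteq> top" by (simp add: ennreal_mult_eq_top_iff)
  then have "D_KL Q P = \<infinity>" using True
    unfolding D_KL_eq by (cases "enn2ereal (ennreal (1 / ln 2) * x_ln_x_neg)") (auto simp: ennreal_mult_top)
  then show ?thesis by (simp add: log2_ereal_def)
next
  case False
  then obtain a where a: "0 \<le> a" "x_ln_x_pos = ennreal a" by (cases x_ln_x_pos) auto
  obtain b where b: "0 \<le> b" "x_ln_x_neg = ennreal b"
    using x_ln_x_neg_le_1 by (cases x_ln_x_neg) (auto simp: top_unique)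
  obtain m where m: "0 \<le> m" "log_moment = ennreal m"
    using log_moment_add_x_ln_x_neg_le a by (cases log_moment) (auto simp: top_unique)
  have ab: "m + b \<le> a" using log_moment_add_x_ln_x_neg_le a b m
    by (simp add: ennreal_plus[symmetric] del: ennreal_plus)
  define \<kappa> where "\<kappa> = (a - b) / ln 2"
  have KL: "D_KL Q P = ereal \<kappa>"
    unfolding D_KL_eq a(2) b(2) using a b by (simp add: ennreal_mult[symmetric] \<kappa>_def diff_divide_distrib)
  have \<kappa>: "0 \<le> \<kappa>" using ab m by (simp add: \<kappa>_def)
  \<comment> \<open>With \<open>k = \<kappa>\<close> the term \<open>(1 + 1 / k) * \<kappa>\<close>
    becomes \<open>\<kappa> + 1\<close>. For \<open>\<kappa> = 0\<close> that term is 0, and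
    \<open>k = 1\<close> yields \<open>log 2 2 = 1\<close>, exactly the claimed bound.\<close>
  define k where "k = (if \<kappa> = 0 then 1 else \<kappa>)"
  have k: "0 < k" using \<kappa> by (simp add: k_def)
  have "tail_entropy \<le> ennreal (ln (1 + k) + (1 + 1 / k) * m)"
    using tail_entropy_le[OF k] k m by (simp add: ennreal_plus ennreal_mult)
  also have "\<dots> \<le> ennreal (ln (1 + k) + (1 + 1 / k) * (a - b))"
    using ab k by (intro ennreal_leI add_left_mono mult_left_mono) auto
  finally have "ennreal (1 / ln 2) * tail_entropy \<le> ennreal (1 / ln 2) * ennreal (ln (1 + k) + (1 + 1 / k) * (a - b))"
    by (rule mult_left_mono) simp
  also have "\<dots> = ennreal (1 / ln 2 * (ln (1 + k) + (1 + 1 / k) * (a - b)))"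
    by (rule ennreal_mult'[symmetric]) simp
  also have "1 / ln 2 * (ln (1 + k) + (1 + 1 / k) * (a - b)) = log 2 (1 + k) + (1 + 1 / k) * \<kappa>"
    by (simp add: \<kappa>_def log_def distrib_left add_divide_distrib)
  also have "\<dots> = \<kappa> + log 2 (\<kappa> + 1) + 1"
    by (auto simp: k_def distrib_right add.commute)
  finally have "ennreal (1 / ln 2) * tail_entropy \<le> ennreal (\<kappa> + log 2 (\<kappa> + 1) + 1)" .
  then have "D_CS Q P \<le> enn2ereal (ennreal (\<kappa> + log 2 (\<kappa> + 1) + 1))"
    unfolding D_CS_eq less_eq_ennreal.rep_eq .
  also have "\<dots> = ereal (\<kappa> + log 2 (\<kappa> + 1) + 1)"
    using \<kappa> by (intro enn2ereal_ennreal) simp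
  also have "\<dots> = D_KL Q P + log2_ereal (D_KL Q P + 1) + 1"
    using \<kappa> by (simp add: KL log2_ereal_def one_ereal_def)
  finally show ?thesis .
qed

text \<open>Absolute continuity makes \<open>x\<close> an atom, of mass \<open>p > 0\<close>; the
  derivative is then \<open>1 / p\<close> at \<open>x\<close> and 0 elsewhere, a two-valued
  variable.\<close>

lemma D_CS_return:
  assumes x: "{x} \<in> sets P" and Q: "Q = return P x"
  shows "D_CS Q P = ereal (- log 2 (measure P {x}))"
proof -
  have xs: "x \<in> space P" using x sets.sets_into_space by blast
  define p where "p = measure P {x}"
  have "p \<noteq> 0"
  proof
    assume "p = 0"
    then have "{x} \<in> null_sets P" using x by (simp add: null_sets_def p_def P.emeasure_eq_measure)
    then have "{x} \<in> null_sets Q" using ac by (auto simp: absolutely_continuous_def)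
    then show False using x xs by (simp add: Q null_sets_def)
  qed
  then have p: "0 < p" by (simp add: p_def less_le)
  have "density P (\<lambda>y. ennreal (1 / p) * indicator {x} y) = Q"
  proof (rule measure_eqI)
    fix A assume "A \<in> sets (density P (\<lambda>y. ennreal (1 / p) * indicator {x} y))"
    then have [measurable]: "A \<in> sets P" by simp
    note x[measurable]
    have "emeasure (density P (\<lambda>y. ennreal (1 / p) * indicator {x} y)) A =
      (\<integral>\<^sup>+y. ennreal (1 / p) * indicator {x} y * indicator A y \<partial>P)"
      by (rule emeasure_density) measurable
    also have "\<dots> = (\<integral>\<^sup>+y. (ennreal (1 / p) * indicator A x) * indicator {x} y \<partial>P)"
      by (intro nn_integral_cong) (simp split: split_indicator)
    also have "\<dots> = ennreal (1 / p) * ennreal p * indicator A x"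
      using x by (subst nn_integral_cmult_indicator) (auto simp: P.emeasure_eq_measure p_def mult_ac)
    also have "ennreal (1 / p) * ennreal p = 1"
      using p by (simp add: ennreal_mult'[symmetric])
    finally show "emeasure (density P (\<lambda>y. ennreal (1 / p) * indicator {x} y)) A = emeasure Q A"
      by (simp add: Q)
  qed (simp add: Q)
  then have "AE y in P. ennreal (1 / p) * indicator {x} y = RN_deriv P Q y"
    using x by (intro P.RN_deriv_unique) auto
  then have "AE y in P. enn2real (RN_deriv P Q y) = 1 / p * indicator {x} y"
  proof eventually_elim
    case (elim y)
    show ?case unfolding elim[symmetric] using p by (simp split: split_indicator)
  qed
  then have "tail_entropy = ennreal (ln (1 / p))" using p x by (intro tail_entropy_two_valued) auto
  moreover have "0 \<le> ln (1 / p)" using p P.prob_le_1[of "{x}"] by (simp add: p_def)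
  ultimately show ?thesis
    using p unfolding D_CS_eq p_def[symmetric]
    by (simp add: ennreal_mult'[symmetric] ln_div log_def enn2ereal_ennreal divide_nonpos_pos)
qed

end

section \<open>Convexity of the divergence and assembly\<close>

lemma ac_pairI:
  "borel_prob P \<Longrightarrow> borel_prob Q \<Longrightarrow> absolutely_continuous P Q \<Longrightarrow> ac_pair P Q"
  by (simp add: borel_prob_def ac_pair_def ac_pair_axioms_def)

text \<open>By uniqueness of densities the derivative of the mixture is almost everywhere the
  mixture of the derivatives, which reduces the claim to \<open>tail_entropy_convex\<close>.\<close>

lemma D_CS_convex:
  assumes "ac_pair P Q1" "ac_pair P Q2" and l: "0 \<le> l" "l \<le> 1"
  shows "D_CS (mixture l Q1 Q2) P \<le> ereal l * D_CS Q1 P + ereal (1 - l) * D_CS Q2 P"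
proof -
  interpret A: ac_pair P Q1 by fact
  interpret B: ac_pair P Q2 by fact
  let ?Q = "mixture l Q1 Q2"
  have sets: "sets Q2 = sets Q1" using A.sets_Q B.sets_Q by simp
  have ll: "ennreal l + ennreal (1 - l) = 1"
    using l by (simp add: ennreal_plus[symmetric] del: ennreal_plus)
  let ?f = "\<lambda>x. ennreal l * RN_deriv P Q1 x + ennreal (1 - l) * RN_deriv P Q2 x"
  have dens: "density P ?f = ?Q"
  proof (rule measure_eqI)
    fix S assume "S \<in> sets (density P ?f)"
    then have [measurable]: "S \<in> sets P" by simp
    have "emeasure Q1 S = (\<integral>\<^sup>+x. RN_deriv P Q1 x * indicator S x \<partial>P)"
      by (subst A.P.density_RN_deriv[OF A.ac A.sets_Q, symmetric], subst emeasure_density) auto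
    moreover have "emeasure Q2 S = (\<integral>\<^sup>+x. RN_deriv P Q2 x * indicator S x \<partial>P)"
      by (subst A.P.density_RN_deriv[OF B.ac B.sets_Q, symmetric], subst emeasure_density) auto
    ultimately show "emeasure (density P ?f) S = emeasure ?Q S"
      by (simp add: emeasure_density emeasure_mixture sets A.sets_Q distrib_right mult.assoc
          nn_integral_add nn_integral_cmult)
  qed (simp add: A.sets_Q)
  interpret M: ac_pair P ?Q
  proof (intro ac_pair.intro ac_pair_axioms.intro A.P.prob_space_axioms prob_spaceI)
    show "absolutely_continuous P ?Q"
      unfolding dens[symmetric] by (intro absolutely_continuousI_density) auto
    have "emeasure ?Q (space Q1) = 1"
      using sets ll B.Q.emeasure_space_1 unfolding sets_eq_imp_space_eq[OF sets]
      by (subst emeasure_mixture) (auto simp: A.Q.emeasure_space_1)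
    then show "emeasure ?Q (space ?Q) = 1"
      by (simp add: sets_eq_imp_space_eq[OF sets_mixture])
  qed (simp add: A.sets_Q)
  have "AE x in P. ?f x = RN_deriv P ?Q x"
    by (intro A.P.RN_deriv_unique dens) auto
  then have "AE x in P. enn2real (RN_deriv P ?Q x) =
      l * enn2real (RN_deriv P Q1 x) + (1 - l) * enn2real (RN_deriv P Q2 x)"
    using A.AE_RN_deriv B.AE_RN_deriv
  proof eventually_elim
    case (elim x)
    define u v where "u = enn2real (RN_deriv P Q1 x)" and "v = enn2real (RN_deriv P Q2 x)"
    have uv: "0 \<le> u" "0 \<le> v" by (simp_all add: u_def v_def)
    have "RN_deriv P ?Q x = ennreal l * ennreal u + ennreal (1 - l) * ennreal v"
      using elim(1) elim(2)[folded u_def] elim(3)[folded v_def] by simp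
    also have "\<dots> = ennreal (l * u + (1 - l) * v)"
      using l uv by (simp add: ennreal_mult)
    finally show ?case
      unfolding u_def[symmetric] v_def[symmetric] using l uv by (simp del: ennreal_plus)
  qed
  from tail_entropy_convex[OF A.mean_one_axioms B.mean_one_axioms M.mean_one_axioms this l]
  have "ennreal (1 / ln 2) * M.tail_entropy \<le> ennreal (1 / ln 2) * (ennreal l * A.tail_entropy + ennreal (1 - l) * B.tail_entropy)"
    by (rule mult_left_mono) simp
  also have "\<dots> = ennreal l * (ennreal (1 / ln 2) * A.tail_entropy) + ennreal (1 - l) * (ennreal (1 / ln 2) * B.tail_entropy)"
    by (simp add: distrib_left mult_ac)
  finally show ?thesis
    using l by (simp add: A.D_CS_eq B.D_CS_eq M.D_CS_eq less_eq_ennreal.rep_eq plus_ennreal.rep_eq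
        times_ennreal.rep_eq)
qed

theorem mainTheorem4:
  fixes P Q :: "'a::polish_space measure"
  assumes P: "borel_prob P" and Q: "borel_prob Q" and QP: "absolutely_continuous P Q"
  shows "(D_CS Q P \<ge> 0) \<and>
    (D_CS Q P = 0 \<longleftrightarrow> Q = P) \<and>
    (\<forall>Q1 Q2 l. borel_prob Q1 \<and> borel_prob Q2 \<and>
           absolutely_continuous P Q1 \<and> absolutely_continuous P Q2 \<and> 0 \<le> l \<and> l \<le> 1 \<longrightarrow>
           D_CS (mixture l Q1 Q2) P \<le> ereal l * D_CS Q1 P + ereal (1 - l) * D_CS Q2 P) \<and>
    (D_KL Q P \<le> D_CS Q P \<and> D_CS Q P \<le> D_KL Q P + log2_ereal (D_KL Q P + 1) + 1) \<and>
    ((\<forall>A :: 'a set. open A) \<longrightarrow>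
           (\<forall>x. Q = return borel x \<longrightarrow> D_CS Q P = ereal (- log 2 (measure P {x}))))"
proof -
  interpret ac_pair P Q using P Q QP by (rule ac_pairI)
  have sets: "sets P = sets borel" using P by (simp add: borel_prob_def)
  have "0 \<le> D_CS Q P" by (simp add: D_CS_eq)
  \<comment> \<open>Singletons are Borel sets here, and \<open>return borel x\<close> equals
    \<open>return P x\<close> because the two sigma-algebras agree.\<close>
  moreover have "D_CS Q P = ereal (- log 2 (measure P {x}))" if "Q = return borel x" for x
    using that sets by (intro D_CS_return) (auto intro: return_cong)
  ultimately show ?thesis
    using D_CS_eq_0_iff D_CS_convex ac_pairI[OF P] D_KL_le_D_CS D_CS_le by blast
qed

end
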